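(* Let $M$ be a simple connected matroid having no cocircuits of size less than four, and having neither a $U_{2,5}$-minor nor a $U_{3,5}$-minor. Let $e$ be an element of $M$ that is not free. Then $M$ has a hyperplane $H$ with $e\in H$ such that $M|H$ is connected.
   Context: An element $e$ of a matroid $M$ is free if $e$ is not a coloop of $M$ and every circuit of $M$ containing $e$ is spanning. *)

theory Defs
  imports Main
begin

record 'a set_system =
  ground :: "'a set"
  indep :: "'a set set"

locale matroid =
  fixes M :: "'a set_system"
  assumes finite_ground: "finite (ground M)"
    and indep_subset_ground: "X \<in> indep M \<Longrightarrow> X \<subseteq> ground M"
    and empty_indep: "{} \<in> indep M"
    and indep_subset: "X \<in> indep M \<Longrightarrow> Y \<subseteq> X \<Longrightarrow> Y \<in> indep M"
    and augment: "X \<in> indep M \<Longrightarrow> Y \<in> indep M \<Longrightarrow> card X < card Y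
      \<Longrightarrow> \<exists>y \<in> Y - X. insert y X \<in> indep M"

definition basis :: "'a set_system \<Rightarrow> 'a set \<Rightarrow> bool" where
  "basis M B \<longleftrightarrow> B \<in> indep M \<and> (\<forall>X \<in> indep M. B \<subseteq> X \<longrightarrow> X = B)"

definition circuit :: "'a set_system \<Rightarrow> 'a set \<Rightarrow> bool" where
  "circuit M C \<longleftrightarrow> C \<subseteq> ground M \<and> C \<notin> indep M \<and> (\<forall>X. X \<subset> C \<longrightarrow> X \<in> indep M)"

definition rank_of :: "'a set_system \<Rightarrow> 'a set \<Rightarrow> nat" where
  "rank_of M X = Max (card ` {Y \<in> indep M. Y \<subseteq> X})"

definition spanning :: "'a set_system \<Rightarrow> 'a set \<Rightarrow> bool" where
  "spanning M X \<longleftrightarrow> X \<subseteq> ground M \<and> rank_of M X = rank_of M (ground M)"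

definition closure_of :: "'a set_system \<Rightarrow> 'a set \<Rightarrow> 'a set" where
  "closure_of M X = {x \<in> ground M. rank_of M (insert x X) = rank_of M X}"

definition flat :: "'a set_system \<Rightarrow> 'a set \<Rightarrow> bool" where
  "flat M F \<longleftrightarrow> F \<subseteq> ground M \<and> closure_of M F = F"

definition hyperplane :: "'a set_system \<Rightarrow> 'a set \<Rightarrow> bool" where
  "hyperplane M H \<longleftrightarrow> flat M H \<and> rank_of M H + 1 = rank_of M (ground M)"

text \<open>The bases of the dual are the complements of the bases.\<close>

definition dual_of :: "'a set_system \<Rightarrow> 'a set_system" where
  "dual_of M = \<lparr>ground = ground M, indep = {X. \<exists>B. basis M B \<and> X \<subseteq> ground M - B}\<rparr>"

definition cocircuit :: "'a set_system \<Rightarrow> 'a set \<Rightarrow> bool" where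
  "cocircuit M C \<longleftrightarrow> circuit (dual_of M) C"

definition loop :: "'a set_system \<Rightarrow> 'a \<Rightarrow> bool" where
  "loop M e \<longleftrightarrow> circuit M {e}"

definition coloop :: "'a set_system \<Rightarrow> 'a \<Rightarrow> bool" where
  "coloop M e \<longleftrightarrow> loop (dual_of M) e"

definition free_element :: "'a set_system \<Rightarrow> 'a \<Rightarrow> bool" where
  "free_element M e \<longleftrightarrow>
     e \<in> ground M \<and> \<not> coloop M e \<and> (\<forall>C. circuit M C \<and> e \<in> C \<longrightarrow> spanning M C)"

definition parallel :: "'a set_system \<Rightarrow> 'a \<Rightarrow> 'a \<Rightarrow> bool" where
  "parallel M e f \<longleftrightarrow> e \<noteq> f \<and> circuit M {e, f}"

definition simple_matroid :: "'a set_system \<Rightarrow> bool" where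
  "simple_matroid M \<longleftrightarrow> (\<forall>e. \<not> loop M e) \<and> (\<forall>e f. \<not> parallel M e f)"

definition connected_matroid :: "'a set_system \<Rightarrow> bool" where
  "connected_matroid M \<longleftrightarrow>
     (\<forall>e \<in> ground M. \<forall>f \<in> ground M. e \<noteq> f \<longrightarrow> (\<exists>C. circuit M C \<and> e \<in> C \<and> f \<in> C))"

definition restrict_to :: "'a set_system \<Rightarrow> 'a set \<Rightarrow> 'a set_system" where
  "restrict_to M X = \<lparr>ground = X, indep = {Y \<in> indep M. Y \<subseteq> X}\<rparr>"

definition delete :: "'a set_system \<Rightarrow> 'a set \<Rightarrow> 'a set_system" where
  "delete M D = restrict_to M (ground M - D)"

definition contract :: "'a set_system \<Rightarrow> 'a set \<Rightarrow> 'a set_system" where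
  "contract M C = dual_of (delete (dual_of M) C)"

definition isomorphic :: "'a set_system \<Rightarrow> 'b set_system \<Rightarrow> bool" where
  "isomorphic M N \<longleftrightarrow>
     (\<exists>f. bij_betw f (ground M) (ground N) \<and>
          (\<forall>X \<subseteq> ground M. X \<in> indep M \<longleftrightarrow> f ` X \<in> indep N))"

text \<open>As usual, an \<open>N\<close>-minor is a minor isomorphic to \<open>N\<close>.\<close>

definition has_minor :: "'a set_system \<Rightarrow> 'b set_system \<Rightarrow> bool" where
  "has_minor M N \<longleftrightarrow>
     (\<exists>C D. C \<subseteq> ground M \<and> D \<subseteq> ground M \<and> C \<inter> D = {} \<and>
            isomorphic (delete (contract M C) D) N)"

definition uniform :: "nat \<Rightarrow> nat \<Rightarrow> nat set_system" where
  "uniform r n = \<lparr>ground = {..<n}, indep = {X. X \<subseteq> {..<n} \<and> card X \<le> r}\<rparr>"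

end

theory Submission
  imports Defs
begin

text \<open>Let \<open>F\<close> be a maximal connected non-spanning set containing \<open>e\<close>; it is a flat. If it is not
  a hyperplane, let \<open>k \<ge> 2\<close> be its corank. By maximality every circuit meeting both \<open>F\<close> and its
  complement spans together with \<open>F\<close>, so \<open>M/F\<close> is the rank-\<open>k\<close> truncation of \<open>M - F\<close>,
  and the latter has rank greater than \<open>k\<close> because \<open>M\<close> is connected. Excluding \<open>U\<^sub>2\<^sub>,\<^sub>5\<close> and
  \<open>U\<^sub>3\<^sub>,\<^sub>5\<close> from this truncation is very restrictive: for \<open>k = 2\<close> it leaves at most four elements,
  and for \<open>k \<ge> 3\<close> it forces \<open>M - F\<close> to have rank \<open>k + 1\<close> and to be a direct sum of coloops and
  three-point lines. In either case \<open>M/F\<close>, hence \<open>M\<close>, has a cocircuit with at most three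
  elements.\<close>

section \<open>Rank and circuits\<close>

lemma exists_circuit_subset:
  assumes "finite D" "D \<subseteq> ground N" "D \<notin> indep N"
  shows "\<exists>C \<subseteq> D. circuit N C"
  using assms
proof (induction D rule: finite_psubset_induct)
  case (psubset D)
  show ?case
  proof (cases "\<forall>X. X \<subset> D \<longrightarrow> X \<in> indep N")
    case True
    then have "circuit N D"
      using psubset.prems by (auto simp: circuit_def)
    then show ?thesis by blast
  next
    case False
    then obtain X where "X \<subset> D" "X \<notin> indep N" by blast
    then show ?thesis
      using psubset.IH[of X] psubset.prems by blast
  qed
qed

context matroid
begin

abbreviation rk :: "'a set \<Rightarrow> nat" where
  "rk \<equiv> rank_of M"

lemma indep_finite: "X \<in> indep M \<Longrightarrow> finite X"
  using finite_ground indep_subset_ground finite_subset by blast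

lemma subset_ground_finite: "X \<subseteq> ground M \<Longrightarrow> finite X"
  using finite_ground finite_subset by blast

lemma indep_subsets_finite: "finite {Y \<in> indep M. Y \<subseteq> X}"
  by (rule finite_subset[of _ "Pow (ground M)"]) (auto simp: finite_ground dest: indep_subset_ground)

lemma indep_card_le_rk: "Y \<in> indep M \<Longrightarrow> Y \<subseteq> X \<Longrightarrow> card Y \<le> rk X"
  unfolding rank_of_def using indep_subsets_finite by (intro Max_ge) auto

lemma rk_witness: "\<exists>B \<in> indep M. B \<subseteq> X \<and> card B = rk X"
proof -
  have "rk X \<in> card ` {Y \<in> indep M. Y \<subseteq> X}"
    unfolding rank_of_def using indep_subsets_finite empty_indep by (intro Max_in) auto
  then show ?thesis by auto
qed

lemma rk_mono:
  assumes "X \<subseteq> Y"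
  shows "rk X \<le> rk Y"
proof -
  obtain B where B: "B \<in> indep M" "B \<subseteq> X" "card B = rk X" using rk_witness by blast
  have "B \<subseteq> Y" using B(2) assms by (rule order_trans)
  then show ?thesis using indep_card_le_rk[OF B(1)] B(3) by simp
qed

lemma rk_le_card:
  assumes "finite X"
  shows "rk X \<le> card X"
proof -
  obtain B where B: "B \<in> indep M" "B \<subseteq> X" "card B = rk X" using rk_witness by blast
  then show ?thesis using card_mono[OF assms B(2)] by simp
qed

lemma indep_rk:
  assumes "X \<in> indep M"
  shows "rk X = card X"
  using indep_card_le_rk[OF assms order_refl] rk_le_card[OF indep_finite[OF assms]] by simp

lemma indep_iff_rk:
  assumes "X \<subseteq> ground M"
  shows "X \<in> indep M \<longleftrightarrow> rk X = card X"
proof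
  assume eq: "rk X = card X"
  obtain B where B: "B \<in> indep M" "B \<subseteq> X" "card B = rk X" using rk_witness by blast
  have "B = X"
    by (rule card_subset_eq[OF subset_ground_finite[OF assms] B(2)]) (simp add: B(3) eq)
  then show "X \<in> indep M" using B(1) by simp
qed (rule indep_rk)

lemma extend_indep:
  assumes "I \<in> indep M" "I \<subseteq> X"
  shows "\<exists>B \<in> indep M. I \<subseteq> B \<and> B \<subseteq> X \<and> card B = rk X"
  using assms
proof (induction "rk X - card I" arbitrary: I rule: less_induct)
  case less
  obtain A where A: "A \<in> indep M" "A \<subseteq> X" "card A = rk X"
    using rk_witness by blast
  show ?case
  proof (cases "card I < card A")
    case True
    then obtain y where y: "y \<in> A - I" "insert y I \<in> indep M"
      using augment A(1) less.prems by blast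
    have "card (insert y I) = Suc (card I)"
      using y indep_finite less.prems by auto
    then have "rk X - card (insert y I) < rk X - card I"
      using True A by simp
    moreover have "insert y I \<subseteq> X" using y A less.prems by blast
    ultimately have "\<exists>B\<in>indep M. insert y I \<subseteq> B \<and> B \<subseteq> X \<and> card B = rk X"
      using less.hyps[of "insert y I"] y by simp
    then show ?thesis by blast
  next
    case False
    then have "card I = rk X"
      using A indep_card_le_rk[OF less.prems] by simp
    then show ?thesis using less.prems by blast
  qed
qed

text \<open>Extend a maximum independent subset \<open>A\<close> of the intersection to a maximum
  one \<open>B\<close> of the union. The traces of \<open>B\<close> on \<open>X\<close> and
  \<open>Y\<close> are independent, cover \<open>B\<close>, and overlap in at least
  \<open>A\<close>.\<close>

lemma rk_submodular: "rk (X \<union> Y) + rk (X \<inter> Y) \<le> rk X + rk Y"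
proof -
  obtain A where A: "A \<in> indep M" "A \<subseteq> X \<inter> Y" "card A = rk (X \<inter> Y)"
    using rk_witness by blast
  obtain B where B: "B \<in> indep M" "A \<subseteq> B" "B \<subseteq> X \<union> Y" "card B = rk (X \<union> Y)"
    using extend_indep[of A "X \<union> Y"] A by blast
  have fin: "finite B" using B indep_finite by blast
  have "B \<inter> X \<in> indep M" "B \<inter> Y \<in> indep M"
    using indep_subset[OF B(1)] by simp_all
  then have "card (B \<inter> X) \<le> rk X" "card (B \<inter> Y) \<le> rk Y"
    by (auto intro: indep_card_le_rk)
  moreover have "card (B \<inter> X) + card (B \<inter> Y) = card B + card (B \<inter> (X \<inter> Y))"
  proof -
    have "B \<inter> X \<union> B \<inter> Y = B" "B \<inter> X \<inter> (B \<inter> Y) = B \<inter> (X \<inter> Y)" using B(3) by auto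
    then show ?thesis using card_Un_Int[of "B \<inter> X" "B \<inter> Y"] fin by simp
  qed
  moreover have "card A \<le> card (B \<inter> (X \<inter> Y))"
    using A B fin by (intro card_mono) auto
  ultimately show ?thesis using A B by linarith
qed

lemma rk_Un_le: "rk (X \<union> Y) \<le> rk X + rk Y"
  using rk_submodular[of X Y] by linarith

text \<open>A subset of full rank spans \<open>X\<close> and may replace it in every union: apply
  submodularity to \<open>X\<close> and \<open>A \<union> Z\<close>, whose intersection contains
  \<open>A\<close>.\<close>

lemma rk_Un_basis:
  assumes "A \<subseteq> X" "rk A = rk X"
  shows "rk (X \<union> Z) = rk (A \<union> Z)"
proof -
  have "X \<union> (A \<union> Z) = X \<union> Z" using assms by blast
  moreover have "rk A \<le> rk (X \<inter> (A \<union> Z))" using assms by (intro rk_mono) blast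
  ultimately have "rk (X \<union> Z) \<le> rk (A \<union> Z)"
    using rk_submodular[of X "A \<union> Z"] assms by simp
  moreover have "rk (A \<union> Z) \<le> rk (X \<union> Z)" using assms by (intro rk_mono) blast
  ultimately show ?thesis by simp
qed

lemma spanned_mono:
  assumes "rk (insert x X) = rk X" "X \<subseteq> Y"
  shows "rk (insert x Y) = rk Y"
proof (cases "x \<in> Y")
  case False
  then have "insert x X \<union> Y = insert x Y" "insert x X \<inter> Y = X"
    using assms by auto
  then have "rk (insert x Y) \<le> rk Y"
    using rk_submodular[of "insert x X" Y] assms by simp
  moreover have "rk Y \<le> rk (insert x Y)" by (rule rk_mono) blast
  ultimately show ?thesis by simp
qed (simp add: insert_absorb)

lemma rk_Un_spanned:
  assumes "finite Y" "\<And>y. y \<in> Y \<Longrightarrow> rk (insert y X) = rk X"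
  shows "rk (X \<union> Y) = rk X"
  using assms
proof (induction Y)
  case (insert y Y)
  have "rk (insert y (X \<union> Y)) = rk (X \<union> Y)"
    by (rule spanned_mono[of y X]) (auto simp: insert.prems)
  then show ?case using insert by simp
qed simp

section \<open>Circuits: spanning, elimination, exchange and transitivity\<close>

lemma circuit_finite: "circuit M C \<Longrightarrow> finite C"
  by (simp add: circuit_def subset_ground_finite)

lemma circuit_not_subset_indep: "circuit M C \<Longrightarrow> C \<subseteq> I \<Longrightarrow> I \<notin> indep M"
  using indep_subset[of I C] by (auto simp: circuit_def)

lemma circuit_subset_eq: "circuit M C \<Longrightarrow> circuit M D \<Longrightarrow> C \<subseteq> D \<Longrightarrow> C = D"
  unfolding circuit_def by blast

lemma dependent_contains_circuit:
  "X \<subseteq> ground M \<Longrightarrow> X \<notin> indep M \<Longrightarrow> \<exists>C \<subseteq> X. circuit M C"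
  using exists_circuit_subset[OF subset_ground_finite] by simp

lemma circuit_spans:
  assumes "circuit M C" "x \<in> C" "C - {x} \<subseteq> X"
  shows "rk (insert x X) = rk X"
proof -
  have ind: "C - {x} \<in> indep M" and sub: "C \<subseteq> ground M" and dep: "C \<notin> indep M"
    using assms unfolding circuit_def by auto
  have "rk C \<noteq> card C"
    using sub dep indep_iff_rk by blast
  then have "rk C < card C"
    using rk_le_card[OF circuit_finite[OF assms(1)]] by linarith
  moreover have "card C = Suc (card (C - {x}))"
    using card.remove[OF circuit_finite[OF assms(1)] assms(2)] by simp
  moreover have "card (C - {x}) \<le> rk C"
    using ind indep_card_le_rk by blast
  ultimately have "rk C = rk (C - {x})"
    using indep_rk[OF ind] by linarith
  moreover have "insert x (C - {x}) = C" using assms by auto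
  ultimately show ?thesis
    using spanned_mono[of x "C - {x}" X] assms by simp
qed

lemma spanned_circuit:
  assumes "X \<subseteq> ground M" "x \<in> ground M" "x \<notin> X" "rk (insert x X) = rk X"
  shows "\<exists>C. circuit M C \<and> x \<in> C \<and> C \<subseteq> insert x X"
proof -
  obtain B where B: "B \<in> indep M" "B \<subseteq> X" "card B = rk X"
    using rk_witness by blast
  have "x \<notin> B" using B assms by blast
  then have "card (insert x B) = Suc (rk X)"
    using B indep_finite[OF B(1)] by simp
  then have "insert x B \<notin> indep M"
    using indep_card_le_rk[of "insert x B" "insert x X"] B assms by auto
  moreover have "insert x B \<subseteq> ground M" using B assms by blast
  ultimately obtain C where C: "C \<subseteq> insert x B" "circuit M C"
    using dependent_contains_circuit by blast
  then have "x \<in> C" using B circuit_not_subset_indep by blast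
  then show ?thesis using B C by blast
qed

text \<open>From the union without \<open>x\<close> and \<open>f\<close>, the circuit
  \<open>D\<close> spans \<open>f\<close>, and then \<open>C\<close> spans \<open>x\<close>. So
  \<open>x\<close> is already spanned without \<open>f\<close>, and \<open>spanned_circuit\<close>
  applies.\<close>

lemma strong_circuit_elimination:
  assumes "circuit M C" "circuit M D" "f \<in> C \<inter> D" "x \<in> C - D"
  shows "\<exists>K. circuit M K \<and> x \<in> K \<and> K \<subseteq> C \<union> D - {f}"
proof -
  let ?X = "C \<union> D - {x, f}"
  have "rk (insert f ?X) = rk ?X"
    by (rule circuit_spans[OF assms(2)]) (use assms in auto)
  moreover have "rk (insert x (insert f ?X)) = rk (insert f ?X)"
    by (rule circuit_spans[OF assms(1)]) (use assms in auto)
  moreover have "rk ?X \<le> rk (insert x ?X)" "rk (insert x ?X) \<le> rk (insert x (insert f ?X))"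
    by (rule rk_mono, blast)+
  ultimately have "rk (insert x ?X) = rk ?X" by linarith
  moreover have "?X \<subseteq> ground M" "x \<in> ground M"
    using assms unfolding circuit_def by auto
  ultimately obtain K where "circuit M K" "x \<in> K" "K \<subseteq> insert x ?X"
    using spanned_circuit[of ?X x] by auto
  moreover have "insert x ?X \<subseteq> C \<union> D - {f}" using assms by auto
  ultimately show ?thesis by blast
qed

lemma circuit_elimination:
  assumes "circuit M C" "circuit M D" "C \<noteq> D" "f \<in> C \<inter> D"
  shows "\<exists>K. circuit M K \<and> K \<subseteq> C \<union> D - {f}"
proof -
  obtain x where "x \<in> C - D" using assms circuit_subset_eq by blast
  then show ?thesis using strong_circuit_elimination assms by blast
qed

text \<open>Two different circuits would both contain \<open>x\<close>, and eliminating it would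
  leave a circuit inside \<open>I\<close>.\<close>

lemma fundamental_circuit_unique:
  assumes "circuit M C" "circuit M D" "C \<subseteq> insert x I" "D \<subseteq> insert x I" "I \<in> indep M"
  shows "C = D"
proof (rule ccontr)
  assume "C \<noteq> D"
  moreover have "x \<in> C \<inter> D" using assms circuit_not_subset_indep by blast
  ultimately obtain K where "circuit M K" "K \<subseteq> C \<union> D - {x}"
    using circuit_elimination assms by blast
  then show False using assms circuit_not_subset_indep[of K I] by blast
qed

lemma circuit_exchange:
  assumes "circuit M C" "C \<subseteq> insert x I" "I \<in> indep M" "x \<notin> I" "j \<in> C" "j \<noteq> x"
  shows "insert x (I - {j}) \<in> indep M"
proof (rule ccontr)
  assume dep: "insert x (I - {j}) \<notin> indep M"
  have "x \<in> C" using assms circuit_not_subset_indep by blast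
  then have "insert x (I - {j}) \<subseteq> ground M"
    using assms indep_subset_ground unfolding circuit_def by blast
  then obtain K where K: "circuit M K" "K \<subseteq> insert x (I - {j})"
    using dep dependent_contains_circuit by blast
  then have "K = C" using assms fundamental_circuit_unique[of K C x I] by blast
  then show False using K assms by blast
qed

text \<open>A pair of intersecting circuits through \<open>x\<close> and \<open>y\<close> with minimal union would,
  after eliminating a common element from either side, yield a pair with smaller union.\<close>

lemma circuit_transitive:
  assumes "circuit M C" "circuit M D" "x \<in> C" "y \<in> D" "C \<inter> D \<noteq> {}"
  shows "\<exists>K. circuit M K \<and> x \<in> K \<and> y \<in> K \<and> K \<subseteq> C \<union> D"
  using assms
proof (induction "card (C \<union> D)" arbitrary: C D rule: less_induct)
  case less
  show ?case
  proof (rule ccontr)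
    assume no: "\<not> ?thesis"
    have fin: "finite (C \<union> D)" using less.prems circuit_finite by auto
    have smaller: False
      if "circuit M C'" "circuit M D'" "x \<in> C'" "y \<in> D'" "C' \<inter> D' \<noteq> {}" "C' \<union> D' \<subset> C \<union> D" for C' D'
      using less.hyps[of C' D'] that no psubset_card_mono[OF fin that(6)] by blast
    obtain f where f: "f \<in> C \<inter> D" using less.prems by blast
    have "x \<notin> D" "y \<notin> C" using no less.prems by auto
    obtain C' where C': "circuit M C'" "x \<in> C'" "C' \<subseteq> C \<union> D - {f}"
      using strong_circuit_elimination[of C D f x] f less.prems \<open>x \<notin> D\<close> by blast
    obtain D' where D': "circuit M D'" "y \<in> D'" "D' \<subseteq> D \<union> C - {f}"
      using strong_circuit_elimination[of D C f y] f less.prems \<open>y \<notin> C\<close> by blast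
    have "\<not> C' \<subseteq> C"
      using C' f less.prems circuit_subset_eq by blast
    then have meet1: "C' \<inter> (D - C) \<noteq> {}" using C' by blast
    have "\<not> D' \<subseteq> D"
      using D' f less.prems circuit_subset_eq by blast
    then have meet2: "D' \<inter> (C - D) \<noteq> {}" using D' by blast
    \<comment> \<open>The circuits \<open>C\<close> and \<open>D'\<close> meet, so by minimality
      their union is all of \<open>C \<union> D\<close>. Hence \<open>C'\<close>, which has an
      element in \<open>D - C\<close>, meets \<open>D'\<close>, and neither contains
      \<open>f\<close>.\<close>
    have "D - C \<subseteq> D'"
      using smaller[of C D'] meet2 less.prems D' by blast
    then have "C' \<inter> D' \<noteq> {}" using meet1 by blast
    moreover have "C' \<union> D' \<subset> C \<union> D" using C' D' f by blast
    ultimately show False using smaller C' D' by blast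
  qed
qed

text \<open>The union of maximum independent subsets of \<open>X\<close> and \<open>Y\<close> is too
  large to be independent, and a circuit in it fits inside neither of the two.\<close>

lemma circuit_meeting_both:
  assumes "X \<subseteq> ground M" "Y \<subseteq> ground M" "X \<inter> Y = {}" "rk (X \<union> Y) < rk X + rk Y"
  shows "\<exists>C. circuit M C \<and> C \<subseteq> X \<union> Y \<and> C \<inter> X \<noteq> {} \<and> C \<inter> Y \<noteq> {}"
proof -
  obtain A where A: "A \<in> indep M" "A \<subseteq> X" "card A = rk X" using rk_witness by blast
  obtain B where B: "B \<in> indep M" "B \<subseteq> Y" "card B = rk Y" using rk_witness by blast
  have "card (A \<union> B) = rk X + rk Y"
    using A B assms indep_finite by (subst card_Un_disjoint) auto
  then have "A \<union> B \<notin> indep M"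
    using indep_card_le_rk[of "A \<union> B" "X \<union> Y"] A B assms by auto
  moreover have "A \<union> B \<subseteq> ground M" using A B assms by blast
  ultimately obtain C where C: "C \<subseteq> A \<union> B" "circuit M C"
    using dependent_contains_circuit by blast
  have "\<not> C \<subseteq> A" "\<not> C \<subseteq> B" using C A B circuit_not_subset_indep by blast+
  then have "C \<inter> X \<noteq> {}" "C \<inter> Y \<noteq> {}" using C A B by blast+
  then show ?thesis using C A B by blast
qed

text \<open>Both traces of \<open>C\<close> are proper, hence independent. Extended to maximum
  independent subsets of \<open>X\<close> and \<open>Y\<close>, they have a union that has full rank
  in \<open>X \<union> Y\<close> but contains \<open>C\<close>.\<close>

lemma circuit_across_rk:
  assumes "circuit M C" "C \<subseteq> X \<union> Y" "\<not> C \<subseteq> X" "\<not> C \<subseteq> Y" "X \<inter> Y = {}"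
    "X \<subseteq> ground M" "Y \<subseteq> ground M"
  shows "rk (X \<union> Y) < rk X + rk Y"
proof -
  have "C \<inter> X \<subset> C" "C \<inter> Y \<subset> C" using assms by blast+
  then have "C \<inter> X \<in> indep M" "C \<inter> Y \<in> indep M"
    using assms(1) unfolding circuit_def by blast+
  obtain A where A: "A \<in> indep M" "C \<inter> X \<subseteq> A" "A \<subseteq> X" "card A = rk X"
    using extend_indep[of "C \<inter> X" X] \<open>C \<inter> X \<in> indep M\<close> by blast
  obtain B where B: "B \<in> indep M" "C \<inter> Y \<subseteq> B" "B \<subseteq> Y" "card B = rk Y"
    using extend_indep[of "C \<inter> Y" Y] \<open>C \<inter> Y \<in> indep M\<close> by blast
  have "rk (X \<union> Y) = rk (A \<union> B)"
    using rk_Un_basis[of A X Y] rk_Un_basis[of B Y A] A(3,4) B(3,4) indep_rk[OF A(1)] indep_rk[OF B(1)]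
    by (simp add: Un_commute)
  moreover have "A \<union> B \<notin> indep M"
    by (rule circuit_not_subset_indep[OF assms(1)]) (use A(2) B(2) assms(2) in blast)
  then have "rk (A \<union> B) \<noteq> card (A \<union> B)"
    using indep_iff_rk[of "A \<union> B"] indep_subset_ground[OF A(1)] indep_subset_ground[OF B(1)] by simp
  then have "rk (A \<union> B) < card (A \<union> B)"
    using rk_le_card[of "A \<union> B"] indep_finite[OF A(1)] indep_finite[OF B(1)] by simp
  moreover have "card (A \<union> B) \<le> rk X + rk Y"
    using card_Un_le[of A B] A(4) B(4) by simp
  ultimately show ?thesis by simp
qed

section \<open>Duals, contractions and uniform minors\<close>

lemma basis_iff: "basis M B \<longleftrightarrow> B \<in> indep M \<and> card B = rk (ground M)"
proof
  assume B: "basis M B"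
  then have ind: "B \<in> indep M" by (simp add: basis_def)
  obtain T where T: "T \<in> indep M" "B \<subseteq> T" "card T = rk (ground M)"
    using extend_indep[OF ind indep_subset_ground[OF ind]] by blast
  then have "T = B" using B by (simp add: basis_def)
  then show "B \<in> indep M \<and> card B = rk (ground M)" using T by simp
next
  assume B: "B \<in> indep M \<and> card B = rk (ground M)"
  have "X = B" if "X \<in> indep M" "B \<subseteq> X" for X
  proof -
    have "card X \<le> card B"
      using indep_card_le_rk[OF that(1) indep_subset_ground[OF that(1)]] B by simp
    then show ?thesis using card_seteq[OF indep_finite[OF that(1)] that(2)] by simp
  qed
  then show "basis M B" using B by (simp add: basis_def)
qed

lemma dual_indep_iff:
  "X \<in> indep (dual_of M) \<longleftrightarrow> X \<subseteq> ground M \<and> rk (ground M - X) = rk (ground M)"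
proof
  assume "X \<in> indep (dual_of M)"
  then obtain B where B: "basis M B" "X \<subseteq> ground M - B"
    by (auto simp: dual_of_def)
  then have ind: "B \<in> indep M" and c: "card B = rk (ground M)" by (simp_all add: basis_iff)
  have "B \<subseteq> ground M - X" using B(2) indep_subset_ground[OF ind] by blast
  then have "rk (ground M) \<le> rk (ground M - X)"
    using indep_card_le_rk[OF ind] c by simp
  moreover have "rk (ground M - X) \<le> rk (ground M)" by (rule rk_mono) blast
  ultimately show "X \<subseteq> ground M \<and> rk (ground M - X) = rk (ground M)" using B(2) by auto
next
  assume X: "X \<subseteq> ground M \<and> rk (ground M - X) = rk (ground M)"
  obtain B where B: "B \<in> indep M" "B \<subseteq> ground M - X" "card B = rk (ground M - X)"
    using rk_witness by blast
  then have "basis M B" using X by (simp add: basis_iff)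
  moreover have "X \<subseteq> ground M - B" using X B(2) by blast
  ultimately show "X \<in> indep (dual_of M)" by (auto simp: dual_of_def)
qed

lemma exists_cocircuit_subset:
  assumes "D \<subseteq> ground M" "rk (ground M - D) < rk (ground M)"
  shows "\<exists>C \<subseteq> D. cocircuit M C"
  unfolding cocircuit_def
  by (rule exists_circuit_subset)
    (use assms in \<open>simp_all add: dual_indep_iff subset_ground_finite, simp add: dual_of_def\<close>)

text \<open>Since \<open>contract\<close> is defined by dualizing twice, its usual rank description
  needs a proof. For a maximum independent subset \<open>A\<close> of \<open>K\<close>, both sides
  amount to independence of \<open>A \<union> X\<close>.\<close>

lemma contract_indep_iff:
  assumes K: "K \<subseteq> ground M" and X: "X \<subseteq> ground M - K"
  shows "X \<in> indep (contract M K) \<longleftrightarrow> rk (K \<union> X) = rk K + card X"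
proof -
  define N where "N = delete (dual_of M) K"
  have gN: "ground N = ground M - K"
    by (simp add: N_def delete_def restrict_to_def dual_of_def)
  have iN: "Y \<in> indep N \<longleftrightarrow> Y \<subseteq> ground M - K \<and> rk (ground M - Y) = rk (ground M)" for Y
    unfolding N_def delete_def restrict_to_def
    by (auto simp: dual_indep_iff) (auto simp: dual_of_def)
  have ct: "X \<in> indep (contract M K) \<longleftrightarrow> (\<exists>B. basis N B \<and> X \<subseteq> ground M - K - B)"
    unfolding contract_def N_def[symmetric] by (simp add: dual_of_def[of N] gN)
  obtain A where A: "A \<in> indep M" "A \<subseteq> K" "card A = rk K" using rk_witness by blast
  have finX: "finite X" using X subset_ground_finite by blast
  have finA: "finite A" using indep_finite[OF A(1)] .
  have "A \<inter> X = {}" using A(2) X by blast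
  then have cAX: "card (A \<union> X) = rk K + card X"
    using card_Un_disjoint[OF finA finX] A(3) by simp
  have AX: "A \<union> X \<subseteq> ground M" using A(2) K X by blast
  have AK: "rk (K \<union> Z) = rk (A \<union> Z)" for Z
    by (rule rk_Un_basis[OF A(2)]) (simp add: indep_rk[OF A(1)] A(3))
  show ?thesis
  proof
    assume "X \<in> indep (contract M K)"
    then obtain B where B: "basis N B" "X \<subseteq> ground M - K - B" using ct by blast
    have BN: "B \<in> indep N" using B(1) by (simp add: basis_def)
    \<comment> \<open>A circuit in \<open>A \<union> X\<close> would contain some \<open>x\<close>
      in \<open>X\<close>. The rest of it avoids \<open>insert x B\<close>, so adding
      \<open>x\<close> to \<open>B\<close> keeps the complement spanning, against maximality of
      \<open>B\<close>.\<close>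
    have "A \<union> X \<in> indep M"
    proof (rule ccontr)
      assume "A \<union> X \<notin> indep M"
      then obtain C where C: "C \<subseteq> A \<union> X" "circuit M C"
        using dependent_contains_circuit[OF AX] by blast
      have "\<not> C \<subseteq> A" using circuit_not_subset_indep[OF C(2)] A(1) by blast
      then obtain x where x: "x \<in> C" "x \<in> X" using C(1) by blast
      have BK: "B \<subseteq> ground M - K" "rk (ground M - B) = rk (ground M)"
        using BN iN by simp_all
      have "C - {x} \<subseteq> ground M - insert x B" using C(1) A(2) K B(2) X BK(1) by blast
      then have "rk (insert x (ground M - insert x B)) = rk (ground M - insert x B)"
        by (rule circuit_spans[OF C(2) x(1)])
      moreover have "insert x (ground M - insert x B) = ground M - B"
        using x(2) B(2) by blast
      ultimately have "insert x B \<in> indep N"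
        using BK x(2) X by (auto simp: iN)
      then have "insert x B = B" using B(1) unfolding basis_def by blast
      then show False using x(2) B(2) by blast
    qed
    then show "rk (K \<union> X) = rk K + card X" using indep_rk AK cAX by metis
  next
    assume "rk (K \<union> X) = rk K + card X"
    then have "A \<union> X \<in> indep M" using indep_iff_rk[OF AX] AK cAX by simp
    then obtain T where T: "T \<in> indep M" "A \<union> X \<subseteq> T" "T \<subseteq> ground M" "card T = rk (ground M)"
      using extend_indep[OF _ AX] by blast
    \<comment> \<open>\<open>T\<close> is a basis of \<open>M\<close> extending
      \<open>A \<union> X\<close>. Enlarging \<open>B\<close> by an element \<open>x\<close> of
      \<open>T\<close> outside \<open>K\<close> leaves a complement spanned by
      \<open>T - {x}\<close>, which is too small.\<close>
    define B where "B = ground M - K - T"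
    have "rk (ground M) \<le> rk (ground M - B)"
      using indep_card_le_rk[OF T(1), of "ground M - B"] T(3,4) by (auto simp: B_def)
    moreover have "rk (ground M - B) \<le> rk (ground M)" by (rule rk_mono) blast
    ultimately have BN: "B \<in> indep N" by (auto simp: iN B_def)
    have "B' = B" if B': "B' \<in> indep N" "B \<subseteq> B'" for B'
    proof (rule ccontr)
      assume "B' \<noteq> B"
      then obtain x where x: "x \<in> B'" "x \<notin> B" using B'(2) by blast
      have B'2: "B' \<subseteq> ground M - K" "rk (ground M - B') = rk (ground M)"
        using B'(1) iN by simp_all
      have xT: "x \<in> T" "x \<notin> K" using x B'2(1) by (auto simp: B_def)
      have "ground M - B' \<subseteq> K \<union> (T - {x})" using x B'(2) by (auto simp: B_def)
      then have "rk (ground M) \<le> rk (A \<union> (T - {x}))"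
        using rk_mono B'2(2) AK by metis
      moreover have "A \<union> (T - {x}) = T - {x}" using T(2) A(2) xT(2) by blast
      moreover have "rk (T - {x}) \<le> card (T - {x})"
        using rk_le_card indep_finite[OF T(1)] by simp
      moreover have "card (T - {x}) < card T"
        using card_Diff1_less[OF indep_finite[OF T(1)] xT(1)] .
      ultimately show False using T(4) by simp
    qed
    then have "basis N B" using BN by (simp add: basis_def)
    moreover have "X \<subseteq> ground M - K - B" using X T(2) by (auto simp: B_def)
    ultimately show "X \<in> indep (contract M K)" using ct by blast
  qed
qed

text \<open>The minor contracts \<open>K\<close> and deletes everything else outside
  \<open>Y\<close>; any bijection from \<open>Y\<close> onto an initial segment is an isomorphism,
  as independence depends only on cardinality.\<close>

lemma has_uniform_minor:
  assumes K: "K \<subseteq> ground M" and Y: "Y \<subseteq> ground M - K" "card Y = n"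
    and rk: "\<And>X. X \<subseteq> Y \<Longrightarrow> rk (K \<union> X) = rk K + card X \<longleftrightarrow> card X \<le> m"
  shows "has_minor M (uniform m n)"
proof -
  define D where "D = ground M - K - Y"
  define N where "N = delete (contract M K) D"
  have gc: "ground (contract M K) = ground M - K"
    by (simp add: contract_def dual_of_def delete_def restrict_to_def)
  have gN: "ground N = Y"
    using Y(1) by (auto simp: N_def delete_def restrict_to_def gc D_def)
  have iN: "X \<in> indep N \<longleftrightarrow> card X \<le> m" if "X \<subseteq> Y" for X
  proof -
    have "X \<subseteq> ground M - K" using that Y(1) by blast
    then have "X \<in> indep (contract M K) \<longleftrightarrow> card X \<le> m"
      using contract_indep_iff[OF K] rk[OF that] by simp
    moreover have "ground (contract M K) - D = Y" using Y(1) by (auto simp: gc D_def)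
    ultimately show ?thesis
      using that by (simp add: N_def delete_def restrict_to_def)
  qed
  have "finite Y" using Y(1) subset_ground_finite by blast
  then obtain h where h: "bij_betw h Y {..<n}"
    using ex_bij_betw_finite_nat[of Y] Y(2) by (auto simp: atLeast0LessThan)
  have "X \<in> indep N \<longleftrightarrow> h ` X \<in> indep (uniform m n)" if "X \<subseteq> Y" for X
  proof -
    have "card (h ` X) = card X"
      using card_image[OF inj_on_subset[OF bij_betw_imp_inj_on[OF h] that]] .
    moreover have "h ` X \<subseteq> {..<n}" using h that by (auto simp: bij_betw_def)
    ultimately show ?thesis using iN[OF that] by (simp add: uniform_def)
  qed
  moreover have "ground (uniform m n) = {..<n}" by (simp add: uniform_def)
  ultimately have "isomorphic N (uniform m n)"
    unfolding isomorphic_def using h gN by auto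
  then show ?thesis
    unfolding has_minor_def N_def using K by (intro exI[of _ K] exI[of _ D]) (auto simp: D_def)
qed

section \<open>Connected sets and simplicity\<close>

text \<open>Stated with circuits of \<open>M\<close> itself, so that circuits leaving
  \<open>X\<close> can be used to enlarge it. Singletons qualify vacuously.\<close>

definition connected_set :: "'a set \<Rightarrow> bool" where
  "connected_set X \<longleftrightarrow>
     (\<forall>x \<in> X. \<forall>y \<in> X. x \<noteq> y \<longrightarrow> (\<exists>C \<subseteq> X. circuit M C \<and> x \<in> C \<and> y \<in> C))"

lemma connected_restrict_to_iff:
  assumes "X \<subseteq> ground M"
  shows "connected_matroid (restrict_to M X) \<longleftrightarrow> connected_set X"
proof -
  have circuits: "circuit (restrict_to M X) C \<longleftrightarrow> circuit M C \<and> C \<subseteq> X" for C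
    using assms unfolding circuit_def restrict_to_def by auto
  have ground: "ground (restrict_to M X) = X" by (simp add: restrict_to_def)
  show ?thesis
    unfolding connected_matroid_def connected_set_def circuits ground by blast
qed

text \<open>For \<open>x\<close> in \<open>X\<close> and \<open>y\<close> in \<open>C\<close>, a
  circuit through \<open>x\<close> and a common element \<open>z\<close> is linked to
  \<open>C\<close> by \<open>circuit_transitive\<close>.\<close>

lemma connected_set_Un_circuit:
  assumes "connected_set X" "circuit M C" "C \<inter> X \<noteq> {}"
  shows "connected_set (X \<union> C)"
proof -
  obtain z where z: "z \<in> C" "z \<in> X" using assms(3) by blast
  have mixed: "\<exists>D \<subseteq> X \<union> C. circuit M D \<and> x \<in> D \<and> y \<in> D" if xy: "x \<in> X" "y \<in> C" for x y
  proof (cases "x = z")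
    case True
    then show ?thesis using z(1) xy(2) assms(2) by blast
  next
    case False
    then obtain D where D: "D \<subseteq> X" "circuit M D" "x \<in> D" "z \<in> D"
      using assms(1) xy(1) z(2) unfolding connected_set_def by blast
    have "D \<inter> C \<noteq> {}" using D(4) z(1) by blast
    then obtain K where "circuit M K" "x \<in> K" "y \<in> K" "K \<subseteq> D \<union> C"
      using circuit_transitive[OF D(2) assms(2) D(3) xy(2)] by blast
    then show ?thesis using D(1) by blast
  qed
  show ?thesis
    unfolding connected_set_def
  proof (intro ballI impI)
    fix x y assume xy: "x \<in> X \<union> C" "y \<in> X \<union> C" "x \<noteq> y"
    consider "x \<in> X" "y \<in> X" | "x \<in> C" "y \<in> C" | "x \<in> X" "y \<in> C" | "x \<in> C" "y \<in> X"
      using xy by blast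
    then show "\<exists>D \<subseteq> X \<union> C. circuit M D \<and> x \<in> D \<and> y \<in> D"
    proof cases
      case 1
      then obtain D where "D \<subseteq> X" "circuit M D" "x \<in> D" "y \<in> D"
        using assms(1) xy(3) unfolding connected_set_def by blast
      then show ?thesis by blast
    next
      case 2
      then show ?thesis using assms(2) by blast
    next
      case 3
      then show ?thesis by (rule mixed)
    next
      case 4
      then show ?thesis using mixed[OF 4(2,1)] by blast
    qed
  qed
qed

lemma simple_circuit_card:
  assumes "simple_matroid M" "circuit M C"
  shows "3 \<le> card C"
proof (rule ccontr)
  assume "\<not> 3 \<le> card C"
  then consider "card C = 0" | "card C = 1" | "card C = 2" by linarith
  then show False
  proof cases
    case 1
    then have "C = {}" using circuit_finite[OF assms(2)] by simp
    then show False using assms(2) empty_indep by (simp add: circuit_def)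
  next
    case 2
    then obtain x where "C = {x}" by (auto simp: card_1_singleton_iff)
    then show False using assms by (simp add: simple_matroid_def loop_def)
  next
    case 3
    then obtain x y where "C = {x, y}" "x \<noteq> y" by (auto simp: card_2_iff)
    then show False using assms by (auto simp: simple_matroid_def parallel_def)
  qed
qed

lemma simple_indep:
  assumes "simple_matroid M" "X \<subseteq> ground M" "card X \<le> 2"
  shows "X \<in> indep M"
proof (rule ccontr)
  assume "X \<notin> indep M"
  then obtain C where C: "C \<subseteq> X" "circuit M C"
    using dependent_contains_circuit[OF assms(2)] by blast
  have "card C \<le> card X" using card_mono[OF subset_ground_finite[OF assms(2)] C(1)] .
  then show False using simple_circuit_card[OF assms(1) C(2)] assms(3) by simp
qed

end

section \<open>Sets whose contraction truncates their deletion\<close>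

text \<open>The assumption \<open>rk_Un\<close> says that contracting \<open>F\<close> yields the truncation to rank \<open>k\<close>
  of the matroid obtained by deleting \<open>F\<close>.\<close>

locale truncating_set = matroid +
  fixes F :: "'a set" and k :: nat
  assumes F_subset: "F \<subseteq> ground M"
    and rk_Un: "X \<subseteq> ground M - F \<Longrightarrow> rk (F \<union> X) = rk F + min (rk X) k"
begin

text \<open>Contracting \<open>F \<union> G\<close> leaves rank \<open>m\<close>, so truncation
  alone makes sets with more than \<open>m\<close> elements dependent. Smaller subsets of
  \<open>Y\<close> extend to \<open>m\<close>-subsets because \<open>m \<le> n\<close>, so only
  these need checking.\<close>

lemma truncated_uniform_minor:
  assumes G: "G \<in> indep M" "G \<subseteq> ground M - F" "card G + m = k"
    and Y: "Y \<subseteq> ground M - F - G" "card Y = n" "m \<le> n"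
    and Z: "\<And>Z. Z \<subseteq> Y \<Longrightarrow> card Z = m \<Longrightarrow> G \<union> Z \<in> indep M"
  shows "has_minor M (uniform m n)"
proof (rule has_uniform_minor[where K = "F \<union> G" and Y = Y])
  show "F \<union> G \<subseteq> ground M" "Y \<subseteq> ground M - (F \<union> G)" "card Y = n"
    using F_subset G Y by auto
next
  fix X assume X: "X \<subseteq> Y"
  have finY: "finite Y" using Y(1) subset_ground_finite by blast
  have K: "rk (F \<union> G) = rk F + card G"
    using rk_Un[OF G(2)] indep_rk[OF G(1)] G(3) by simp
  have GX: "G \<union> X \<subseteq> ground M - F" using G(2) X Y(1) by blast
  have eq: "rk (F \<union> G \<union> X) = rk F + min (rk (G \<union> X)) k"
    using rk_Un[OF GX] by (simp add: Un_assoc)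
  show "rk (F \<union> G \<union> X) = rk (F \<union> G) + card X \<longleftrightarrow> card X \<le> m"
  proof (cases "card X \<le> m")
    case True
    obtain Z' where Z': "X \<subseteq> Z'" "Z' \<subseteq> Y" "card Z' = m"
      using exists_subset_between[of X m Y] True Y(2,3) X finY by auto
    have "G \<union> X \<in> indep M"
      by (rule indep_subset[OF Z[OF Z'(2,3)]]) (use Z'(1) in blast)
    then have "rk (G \<union> X) = card (G \<union> X)" by (rule indep_rk)
    also have "\<dots> = card G + card X"
      using indep_finite[OF G(1)] finite_subset[OF X finY] X Y(1)
      by (intro card_Un_disjoint) auto
    finally show ?thesis using eq K True G(3) by simp
  next
    case False
    then show ?thesis using eq K G(3) by simp
  qed
qed

end

text \<open>The condition \<open>cogirth\<close> concerns cocircuits avoiding \<open>F\<close>: by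
  \<open>rk_Un\<close> and \<open>rk_compl\<close>, a set outside \<open>F\<close> spans
  \<open>M\<close> together with \<open>F\<close> exactly when its rank is at least
  \<open>k\<close>.\<close>

locale truncating_set_no_minor = truncating_set +
  assumes simple: "simple_matroid M"
    and no_U25: "\<not> has_minor M (uniform 2 5)"
    and no_U35: "\<not> has_minor M (uniform 3 5)"
    and rk_compl: "k < rk (ground M - F)"
    and cogirth: "D \<subseteq> ground M - F \<Longrightarrow> rk (ground M - F - D) < k \<Longrightarrow> 4 \<le> card D"
begin

text \<open>By simplicity any five elements outside \<open>F\<close> give a U_{2,5}-minor. With at
  most four, all but one of them form a set of at most three elements whose removal leaves rank at
  most 1.\<close>

lemma truncation_rank_ne_2: "k \<noteq> 2"
proof
  assume k: "k = 2"
  let ?S = "ground M - F"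
  have fin: "finite ?S" using finite_ground by simp
  have "card ?S < 5"
  proof (rule ccontr)
    assume "\<not> card ?S < 5"
    then obtain Y where Y: "Y \<subseteq> ?S" "card Y = 5"
      using exists_subset_between[of "{}" 5 ?S] fin by auto
    have "has_minor M (uniform 2 5)"
    proof (rule truncated_uniform_minor[where G = "{}" and Y = Y])
      show "{} \<union> Z \<in> indep M" if "Z \<subseteq> Y" "card Z = 2" for Z
        using simple_indep[OF simple, of Z] that Y(1) by auto
    qed (use Y k empty_indep in auto)
    then show False using no_U25 by simp
  qed
  have "?S \<noteq> {}"
  proof
    assume "?S = {}"
    then have "card ?S = 0" by (metis card.empty)
    then show False using rk_compl rk_le_card[OF fin] by linarith
  qed
  then obtain x where x: "x \<in> ?S" by blast
  have "?S - (?S - {x}) = {x}" using x by blast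
  then have "rk (?S - (?S - {x})) < k" using rk_le_card[of "{x}"] k by simp
  then have "4 \<le> card (?S - {x})" by (intro cogirth) auto
  then show False using \<open>card ?S < 5\<close> x fin by simp
qed

section \<open>Truncations of rank at least three\<close>

context
  assumes k_ge_3: "3 \<le> k"
begin

text \<open>Among \<open>k + 2\<close> independent elements, contracting \<open>k - 3\<close> leaves
  five, which truncation to rank 3 turns into U_{3,5}.\<close>

lemma indep_compl_card:
  assumes "I \<in> indep M" "I \<subseteq> ground M - F"
  shows "card I \<le> k + 1"
proof (rule ccontr)
  assume "\<not> card I \<le> k + 1"
  then obtain J where J: "J \<subseteq> I" "card J = k + 2"
    using exists_subset_between[of "{}" "k + 2" I] indep_finite[OF assms(1)] by auto
  have finJ: "finite J" using J indep_finite[OF assms(1)] finite_subset by blast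
  obtain G where G: "G \<subseteq> J" "card G = k - 3"
    using exists_subset_between[of "{}" "k - 3" J] J(2) finJ by fastforce
  have Jind: "J \<in> indep M" using indep_subset[OF assms(1) J(1)] .
  have "has_minor M (uniform 3 5)"
  proof (rule truncated_uniform_minor[where G = G and Y = "J - G"])
    show "G \<in> indep M" using indep_subset[OF Jind G(1)] .
    show "card (J - G) = 5"
      using card_Diff_subset[OF finite_subset[OF G(1) finJ] G(1)] J(2) G(2) k_ge_3 by simp
    show "G \<union> Z \<in> indep M" if "Z \<subseteq> J - G" "card Z = 3" for Z
      by (rule indep_subset[OF Jind]) (use that G in blast)
  qed (use G J assms(2) k_ge_3 in auto)
  then show False using no_U35 by simp
qed

text \<open>If \<open>C\<close> were larger, choose four elements \<open>A\<close> of
  \<open>I\<close> including three elements \<open>T\<close> of \<open>C\<close>. Contracting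
  \<open>I - A\<close> makes \<open>insert x A\<close> a U_{3,5} in the truncation.\<close>

lemma fundamental_circuit_card:
  assumes I: "I \<in> indep M" "I \<subseteq> ground M - F" "card I = k + 1"
    and x: "x \<in> ground M - F" "x \<notin> I"
    and C: "circuit M C" "C \<subseteq> insert x I"
  shows "card C = 3"
proof (rule ccontr)
  assume "card C \<noteq> 3"
  then have "4 \<le> card C" using simple_circuit_card[OF simple C(1)] by simp
  moreover have finC: "finite C" using circuit_finite[OF C(1)] .
  moreover have xC: "x \<in> C" using circuit_not_subset_indep[OF C(1), of I] I(1) C(2) by blast
  ultimately have "3 \<le> card (C - {x})" by simp
  then obtain T where T: "T \<subseteq> C - {x}" "card T = 3"
    using exists_subset_between[of "{}" 3 "C - {x}"] finC by auto
  have finI: "finite I" using indep_finite[OF I(1)] .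
  have "T \<subseteq> I" using T(1) C(2) by blast
  then obtain A where A: "T \<subseteq> A" "A \<subseteq> I" "card A = 4"
    using exists_subset_between[of T 4 I] T(2) I(3) k_ge_3 finI by auto
  have finA: "finite A" using finite_subset[OF A(2) finI] .
  have "has_minor M (uniform 3 5)"
  proof (rule truncated_uniform_minor[where G = "I - A" and Y = "insert x A"])
    show "I - A \<in> indep M" using indep_subset[OF I(1)] by simp
    show "card (I - A) + 3 = k"
      using card_Diff_subset[OF finA A(2)] A(3) I(3) k_ge_3 by simp
    have "x \<notin> A" using A(2) x(2) by blast
    then show "card (insert x A) = 5" using finA A(3) by simp
    show "I - A \<union> Z \<in> indep M" if Z: "Z \<subseteq> insert x A" "card Z = 3" for Z
    proof (cases "x \<in> Z")
      case True
      have finZ: "finite Z" using finite_subset[OF Z(1)] finA by simp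
      \<comment> \<open>A triple through \<open>x\<close> misses some \<open>j\<close> in
        \<open>T\<close>, and \<open>x\<close> may be exchanged for \<open>j\<close> in
        \<open>I\<close>.\<close>
      have "\<not> T \<subseteq> Z"
      proof
        assume "T \<subseteq> Z"
        then have "T = Z" using card_seteq[OF finZ] T(2) Z(2) by simp
        then show False using True T(1) by blast
      qed
      then obtain j where j: "j \<in> T" "j \<notin> Z" by blast
      have "j \<in> C" "j \<noteq> x" using j(1) T(1) by blast+
      then have "insert x (I - {j}) \<in> indep M"
        by (rule circuit_exchange[OF C I(1) x(2)])
      moreover have "I - A \<union> Z \<subseteq> insert x (I - {j})" using Z(1) A(1,2) j by blast
      ultimately show ?thesis by (rule indep_subset)
    next
      case False
      show ?thesis by (rule indep_subset[OF I(1)]) (use False Z(1) A(2) in blast)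
    qed
  qed (use I(2) A(2) x in auto)
  then show False using no_U35 by simp
qed

lemma fundamental_circuit_triple:
  assumes I: "I \<in> indep M" "I \<subseteq> ground M - F" "card I = k + 1"
    and x: "x \<in> ground M - F" "x \<notin> I"
    and C: "circuit M C" "C \<subseteq> insert x I" and a: "a \<in> C" "a \<in> I"
  obtains b where "C = {x, a, b}" "b \<in> I" "b \<noteq> a" "b \<noteq> x"
proof -
  have xC: "x \<in> C" using circuit_not_subset_indep[OF C(1), of I] I(1) C(2) by blast
  have xa: "x \<noteq> a" using a(2) x(2) by blast
  have "card (C - {x} - {a}) = 1"
    using fundamental_circuit_card[OF I x C] xC a(1) xa circuit_finite[OF C(1)] by simp
  then obtain b where b: "C - {x} - {a} = {b}" by (auto simp: card_1_singleton_iff)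
  show ?thesis
  proof (rule that)
    show "C = {x, a, b}" "b \<noteq> a" "b \<noteq> x" using b xC a(1) by blast+
    then show "b \<in> I" using C(2) by blast
  qed
qed

text \<open>Contracting all but one further element \<open>c\<close> of \<open>I\<close> outside a four-point line \<open>{a, b, x, y}\<close>
  leaves, after truncation to rank two, five points \<open>a, b, x, y, c\<close> on a line.\<close>

lemma no_shared_line:
  assumes I: "I \<in> indep M" "I \<subseteq> ground M - F" "card I = k + 1"
    and xy: "x \<in> ground M - F" "x \<notin> I" "y \<in> ground M - F" "y \<notin> I" "x \<noteq> y"
    and ab: "a \<in> I" "b \<in> I" "a \<noteq> b"
    and C: "circuit M {x, a, b}" and D: "circuit M {y, a, b}"
  shows False
proof -
  have finI: "finite I" using indep_finite[OF I(1)] .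
  have ne: "x \<noteq> a" "x \<noteq> b" "y \<noteq> a" "y \<noteq> b" using ab xy by blast+
  have "{x, a, b} \<noteq> {y, a, b}" using ne xy(5) by blast
  then obtain K where K: "circuit M K" "K \<subseteq> {x, a, b} \<union> {y, a, b} - {b}"
    using circuit_elimination[OF C D, of b] by blast
  have Ksub: "K \<subseteq> {x, y, a}" using K(2) by blast
  moreover have "card {x, y, a} = 3" using ne xy(5) by simp
  ultimately have Keq: "K = {x, y, a}"
    using card_seteq[of "{x, y, a}" K] simple_circuit_card[OF simple K(1)] by simp
  have exx: "insert x (I - {j}) \<in> indep M" if "j \<in> {a, b}" for j
    by (rule circuit_exchange[OF C _ I(1) xy(2)]) (use that ab ne in auto)
  have exy: "insert y (I - {j}) \<in> indep M" if "j \<in> {a, b}" for j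
    by (rule circuit_exchange[OF D _ I(1) xy(4)]) (use that ab ne in auto)
  \<comment> \<open>Here both \<open>a\<close> and \<open>b\<close> are replaced: first
    \<open>b\<close> by \<open>x\<close>, then \<open>a\<close> by \<open>y\<close> along the
    circuit \<open>K\<close>.\<close>
  have exxy: "insert y (insert x (I - {b}) - {a}) \<in> indep M"
    by (rule circuit_exchange[OF K(1) _ exx[of b]]) (use Keq ab ne xy in auto)
  have "card (I - {a, b}) = k - 1"
    using card_Diff_subset[of "{a, b}" I] ab I(3) by simp
  then have "I - {a, b} \<noteq> {}" using k_ge_3 by fastforce
  then obtain c where c: "c \<in> I" "c \<noteq> a" "c \<noteq> b" by blast
  have xyc: "x \<noteq> c" "y \<noteq> c" using c xy by blast+
  have "has_minor M (uniform 2 5)"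
  proof (rule truncated_uniform_minor[where G = "I - {a, b, c}" and Y = "{a, b, c, x, y}"])
    show "I - {a, b, c} \<in> indep M" using indep_subset[OF I(1)] by simp
    show "card (I - {a, b, c}) + 2 = k"
      using card_Diff_subset[of "{a, b, c}" I] ab c I(3) k_ge_3 by simp
    show "card {a, b, c, x, y} = 5" using ne xyc xy(5) ab(3) c by auto
    show "I - {a, b, c} \<union> Z \<in> indep M" if Z: "Z \<subseteq> {a, b, c, x, y}" "card Z = 2" for Z
    proof -
      obtain p q where pq: "Z = {p, q}" "p \<noteq> q" using Z(2) by (auto simp: card_2_iff)
      \<comment> \<open>A pair with exactly one of \<open>x\<close>, \<open>y\<close> misses
        \<open>a\<close> or \<open>b\<close>, so one exchange suffices; only \<open>{x, y}\<close>
        needs two.\<close>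
      consider "Z \<subseteq> {a, b, c}" | "Z = {x, y}"
        | j where "j \<in> {a, b}" "Z \<subseteq> insert x ({a, b, c} - {j})"
        | j where "j \<in> {a, b}" "Z \<subseteq> insert y ({a, b, c} - {j})"
      proof -
        have "Z \<subseteq> {a, b, c} \<or> Z = {x, y} \<or> (\<exists>j \<in> {a, b}. Z \<subseteq> insert x ({a, b, c} - {j}))
          \<or> (\<exists>j \<in> {a, b}. Z \<subseteq> insert y ({a, b, c} - {j}))"
          using Z(1) ne xyc xy(5) ab(3) c unfolding pq(1) by auto
        then show ?thesis using that by blast
      qed
      then show ?thesis
      proof cases
        case 1
        show ?thesis by (rule indep_subset[OF I(1)]) (use 1 ab c in blast)
      next
        case 2
        show ?thesis by (rule indep_subset[OF exxy]) (use 2 ne in blast)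
      next
        case 3
        show ?thesis by (rule indep_subset[OF exx[OF 3(1)]]) (use 3 ab c in blast)
      next
        case 4
        show ?thesis by (rule indep_subset[OF exy[OF 4(1)]]) (use 4 ab c in blast)
      qed
    qed
  qed (use I(2) ab c xy in auto)
  then show False using no_U25 by simp
qed

text \<open>Together with \<open>fundamental_circuit_card\<close>, this gives the direct sum of
  coloops and three-point lines. Triples sharing two elements of \<open>I\<close> are excluded by
  \<open>no_shared_line\<close>; the other case is that of exactly one.\<close>

lemma fundamental_circuits_disjoint:
  assumes I: "I \<in> indep M" "I \<subseteq> ground M - F" "card I = k + 1"
    and x: "x \<in> ground M - F" "x \<notin> I" and y: "y \<in> ground M - F" "y \<notin> I" and xy: "x \<noteq> y"
    and C: "circuit M C" "C \<subseteq> insert x I" and D: "circuit M D" "D \<subseteq> insert y I"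
  shows "C \<inter> D = {}"
proof (rule ccontr)
  assume "C \<inter> D \<noteq> {}"
  then obtain a where a: "a \<in> C" "a \<in> D" by blast
  have aI: "a \<in> I" using a C(2) D(2) xy by blast
  obtain b where b: "C = {x, a, b}" "b \<in> I" "b \<noteq> a" "b \<noteq> x"
    using fundamental_circuit_triple[OF I x C a(1) aI] by blast
  obtain c where c: "D = {y, a, c}" "c \<in> I" "c \<noteq> a" "c \<noteq> y"
    using fundamental_circuit_triple[OF I y D a(2) aI] by blast
  have ne: "x \<noteq> a" "y \<noteq> a" "x \<noteq> c" "y \<noteq> b" using aI b(2) c(2) x y by blast+
  show False
  proof (cases "b = c")
    case True
    then show False
      using no_shared_line[OF I x y xy aI b(2)] b(1,3) c(1) C(1) D(1) by simp
  next
    case False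
    \<comment> \<open>After exchanging \<open>a\<close> for \<open>x\<close>, the fundamental circuit \<open>K\<close> of \<open>y\<close> must again be a triple,
      which makes two of the lines \<open>C\<close>, \<open>D\<close>, \<open>K\<close> coincide.\<close>
    have abcI: "{a, b, c} \<subseteq> I" using aI b(2) c(2) by simp
    have CD: "C \<noteq> D" using b(1) c(1) ne xy False by blast
    then obtain K where K: "circuit M K" "K \<subseteq> C \<union> D - {a}"
      using circuit_elimination[OF C(1) D(1)] a by blast
    define I' where "I' = insert x (I - {a})"
    have I': "I' \<in> indep M" unfolding I'_def
      by (rule circuit_exchange[OF C I(1) x(2) a(1)]) (use ne in simp)
    have I'c: "card I' = k + 1"
      unfolding I'_def using I(3) aI x(2) indep_finite[OF I(1)] by simp
    have I's: "I' \<subseteq> ground M - F" using I(2) x(1) by (auto simp: I'_def)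
    have yI': "y \<notin> I'" using y(2) xy by (auto simp: I'_def)
    have KI': "K \<subseteq> insert y I'" using K(2) b(1,2) c(1,2) by (auto simp: I'_def)
    have "y \<in> K" using circuit_not_subset_indep[OF K(1), of I'] I' KI' by blast
    have "x \<in> K"
    proof (rule ccontr)
      assume "x \<notin> K"
      then have "K \<subseteq> insert y I" using K(2) b(1) c(1) abcI by blast
      then have "K = D" using fundamental_circuit_unique[OF K(1) D(1) _ D(2) I(1)] by blast
      then show False using K(2) a by blast
    qed
    have "card (K - {y} - {x}) = 1"
      using fundamental_circuit_card[OF I' I's I'c y(1) yI' K(1) KI'] \<open>x \<in> K\<close> \<open>y \<in> K\<close> xy
        circuit_finite[OF K(1)] by simp
    then obtain d where d: "K - {y} - {x} = {d}" by (auto simp: card_1_singleton_iff)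
    then have "d \<in> {b, c}" using K(2) b(1) c(1) by blast
    then show False
    proof
      assume "d = b"
      then have Keq: "K = {x, y, b}" using d \<open>x \<in> K\<close> \<open>y \<in> K\<close> by blast
      have "K \<noteq> C" using K(2) a by blast
      moreover have "x \<in> K \<inter> C" using Keq b(1) by simp
      \<comment> \<open>Eliminating \<open>x\<close> leaves a circuit within
        \<open>{y, a, b}\<close>, which must be \<open>D\<close> by uniqueness, although
        \<open>D\<close> contains \<open>c\<close>. The case of \<open>c\<close> is
        symmetric.\<close>
      ultimately obtain L where L: "circuit M L" "L \<subseteq> K \<union> C - {x}"
        using circuit_elimination[OF K(1) C(1)] by blast
      have "L \<subseteq> insert y {a, b}" using L(2) Keq b(1) by blast
      then have "L = D"
        using fundamental_circuit_unique[OF L(1) D(1) _ D(2) I(1)] abcI by blast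
      then have "c \<in> insert y {a, b}" using \<open>L \<subseteq> insert y {a, b}\<close> c(1) by blast
      then show False using False c(3,4) by blast
    next
      assume "d \<in> {c}"
      then have Keq: "K = {x, y, c}" using d \<open>x \<in> K\<close> \<open>y \<in> K\<close> by blast
      have "K \<noteq> D" using K(2) a by blast
      moreover have "y \<in> K \<inter> D" using Keq c(1) by simp
      ultimately obtain L where L: "circuit M L" "L \<subseteq> K \<union> D - {y}"
        using circuit_elimination[OF K(1) D(1)] by blast
      have "L \<subseteq> insert x {a, c}" using L(2) Keq c(1) by blast
      then have "L = C"
        using fundamental_circuit_unique[OF L(1) C(1) _ C(2) I(1)] abcI by blast
      then have "b \<in> insert x {a, c}" using \<open>L \<subseteq> insert x {a, c}\<close> b(1) by blast
      then show False using False b(3,4) by blast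
    qed
  qed
qed

text \<open>The rank outside \<open>F\<close> is \<open>k + 1\<close>, and removing two coloops or
  one three-point line lowers it to at most \<open>k - 1\<close>, against
  \<open>cogirth\<close>.\<close>

lemma truncation_rank_not_ge_3: False
proof -
  let ?S = "ground M - F"
  obtain I where I: "I \<in> indep M" "I \<subseteq> ?S" "card I = rk ?S" using rk_witness by blast
  have rkS: "rk ?S = k + 1" using indep_compl_card[OF I(1,2)] I(3) rk_compl by simp
  have cI: "card I = k + 1" using I(3) rkS by simp
  have finI: "finite I" using indep_finite[OF I(1)] .
  have circ: "\<exists>C. circuit M C \<and> x \<in> C \<and> C \<subseteq> insert x I" if x: "x \<in> ?S" "x \<notin> I" for x
  proof (rule spanned_circuit)
    have "rk (insert x I) \<le> rk ?S" using x(1) I(2) by (intro rk_mono) blast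
    moreover have "rk I \<le> rk (insert x I)" by (rule rk_mono) blast
    ultimately show "rk (insert x I) = rk I" using indep_rk[OF I(1)] I(3) by simp
  qed (use x I(2) in auto)
  have "\<exists>D \<subseteq> ?S. card D \<le> 3 \<and> rk (?S - D) < k"
  proof (cases "?S = I")
    case True
    obtain D where D: "D \<subseteq> I" "card D = 2"
      using exists_subset_between[of "{}" 2 I] cI k_ge_3 finI by auto
    have "rk (I - D) \<le> card (I - D)" using rk_le_card finI by simp
    also have "\<dots> < k"
      using card_Diff_subset[OF finite_subset[OF D(1) finI] D(1)] cI D(2) k_ge_3 by simp
    finally show ?thesis unfolding True using D by (intro exI[of _ D]) simp
  next
    case False
    then obtain x where x: "x \<in> ?S" "x \<notin> I" using I(2) by blast
    obtain C where C: "circuit M C" "x \<in> C" "C \<subseteq> insert x I" using circ[OF x] by blast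
    have cC: "card C = 3" by (rule fundamental_circuit_card[OF I(1,2) cI x C(1,3)])
    have finC: "finite C" using circuit_finite[OF C(1)] .
    have "card (C \<inter> I) = 2"
    proof -
      have "C \<inter> I = C - {x}" using C(3) x(2) by blast
      then show ?thesis using cC C(2) finC by simp
    qed
    then have cIC: "card (I - C) = k - 1"
      using card_Diff_subset_Int[of I C] finI cI by (simp add: Int_commute)
    \<comment> \<open>The fundamental circuit of \<open>y\<close> is disjoint from \<open>C\<close>,
      so \<open>I - C\<close>, which lost only two elements of \<open>I\<close>, still spans
      \<open>y\<close>.\<close>
    have "rk (insert y (I - C)) = rk (I - C)" if y: "y \<in> ?S - C" for y
    proof (cases "y \<in> I")
      case True
      then have "insert y (I - C) = I - C" using y by blast
      then show ?thesis by simp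
    next
      case False
      obtain D where D: "circuit M D" "y \<in> D" "D \<subseteq> insert y I" using circ[of y] False y by blast
      have "x \<noteq> y" using C(2) y by blast
      then have "C \<inter> D = {}"
        using fundamental_circuits_disjoint[OF I(1,2) cI x _ False _ C(1,3) D(1,3)] y by blast
      then show ?thesis
        by (intro circuit_spans[OF D(1,2)]) (use D(3) in blast)
    qed
    then have "rk (I - C \<union> (?S - C)) = rk (I - C)"
      using finite_ground by (intro rk_Un_spanned) auto
    moreover have "I - C \<union> (?S - C) = ?S - C" using I(2) by blast
    moreover have "rk (I - C) \<le> k - 1" using rk_le_card[of "I - C"] finI cIC by simp
    ultimately have "rk (?S - C) < k" using k_ge_3 by simp
    moreover have "C \<subseteq> ?S" using C(3) x(1) I(2) by blast
    ultimately show ?thesis using cC by (intro exI[of _ C]) (simp del: Diff_subset_conv)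
  qed
  then obtain D where D: "D \<subseteq> ?S" "card D \<le> 3" "rk (?S - D) < k" by blast
  then show False using cogirth[OF D(1,3)] by simp
qed

end

lemma truncation_rank_le_1: "k \<le> 1"
  using truncation_rank_ne_2 truncation_rank_not_ge_3 by (cases "3 \<le> k") auto

end

section \<open>The maximal connected non-spanning set and its corank\<close>

theorem theorem3p7:
  fixes M :: "'a set_system" and e :: 'a
  assumes "matroid M"
    and "simple_matroid M"
    and "connected_matroid M"
    and "\<And>C. cocircuit M C \<Longrightarrow> \<not> card C < 4"
    and "\<not> has_minor M (uniform 2 5)"
    and "\<not> has_minor M (uniform 3 5)"
    and "e \<in> ground M"
    and "\<not> free_element M e"
  shows "\<exists>H. hyperplane M H \<and> e \<in> H \<and> connected_matroid (restrict_to M H)"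
proof -
  interpret matroid M by fact
  note simple = assms(2) and e = assms(7)
  let ?E = "ground M"
  have cogirth: "4 \<le> card D" if D: "D \<subseteq> ?E" "rk (?E - D) < rk ?E" for D
  proof -
    obtain C where C: "C \<subseteq> D" "cocircuit M C" using exists_cocircuit_subset[OF D] by blast
    have "card C \<le> card D" using card_mono[OF subset_ground_finite[OF D(1)] C(1)] .
    then show ?thesis using assms(4)[OF C(2)] by simp
  qed
  have rk_e: "rk {e} = 1"
    using indep_rk[OF simple_indep[OF simple, of "{e}"]] e by simp
  \<comment> \<open>This puts \<open>{e}\<close> into the family \<open>\<F>\<close> below. If
    \<open>e\<close> were the only element, removing it would lower the rank, against
    \<open>cogirth\<close>.\<close>
  have "rk {e} < rk ?E"
  proof (cases "?E = {e}")
    case True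
    have "rk (?E - {e}) < rk ?E" using True rk_e rk_le_card[of "{}"] by simp
    then have "4 \<le> card {e}" using e by (intro cogirth) auto
    then show ?thesis by simp
  next
    case False
    then obtain x where x: "x \<in> ?E" "x \<noteq> e" using e by blast
    have "{x, e} \<in> indep M" using x e by (intro simple_indep[OF simple]) auto
    then have "card {x, e} \<le> rk ?E" using x e by (intro indep_card_le_rk) auto
    then show ?thesis using x rk_e by simp
  qed
  define \<F> where "\<F> = {X. X \<subseteq> ?E \<and> e \<in> X \<and> connected_set X \<and> rk X < rk ?E}"
  have "\<F> \<subseteq> Pow ?E" by (auto simp: \<F>_def)
  then have fin: "finite \<F>" by (rule finite_subset) (simp add: finite_ground)
  have "connected_set {e}" by (auto simp: connected_set_def)
  then have "{e} \<in> \<F>" using e \<open>rk {e} < rk ?E\<close> by (simp add: \<F>_def)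
  then obtain F where F: "F \<in> \<F>" and max: "\<And>X. X \<in> \<F> \<Longrightarrow> F \<subseteq> X \<Longrightarrow> F = X"
    using finite_has_maximal[OF fin] by blast
  have FE: "F \<subseteq> ?E" "e \<in> F" "connected_set F" "rk F < rk ?E" using F by (auto simp: \<F>_def)
  have grow: "rk ?E \<le> rk (F \<union> C)" if C: "circuit M C" "C \<inter> F \<noteq> {}" "\<not> C \<subseteq> F" for C
  proof (rule ccontr)
    assume "\<not> rk ?E \<le> rk (F \<union> C)"
    moreover have "C \<subseteq> ?E" using C(1) by (simp add: circuit_def)
    ultimately have "F \<union> C \<in> \<F>"
      using FE connected_set_Un_circuit[OF FE(3) C(1,2)] by (simp add: \<F>_def)
    then show False using max[of "F \<union> C"] C(3) by blast
  qed
  have flat: "flat M F"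
    unfolding flat_def closure_of_def
  proof (intro conjI FE(1) equalityI subsetI)
    fix x assume "x \<in> {x \<in> ?E. rk (insert x F) = rk F}"
    then have x: "x \<in> ?E" "rk (insert x F) = rk F" by auto
    show "x \<in> F"
    proof (rule ccontr)
      \<comment> \<open>A circuit through \<open>x\<close> inside \<open>insert x F\<close> meets
        \<open>F\<close> by simplicity, so by \<open>grow\<close> the set \<open>insert x F\<close>
        would span \<open>M\<close> with only the rank of \<open>F\<close>.\<close>
      assume xF: "x \<notin> F"
      then obtain C where C: "circuit M C" "x \<in> C" "C \<subseteq> insert x F"
        using spanned_circuit[OF FE(1) x(1) _ x(2)] by blast
      have "C \<inter> F \<noteq> {}"
      proof
        assume "C \<inter> F = {}"
        then have "C = {x}" using C(2,3) by blast
        then show False using simple_circuit_card[OF simple C(1)] by simp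
      qed
      then have "rk ?E \<le> rk (F \<union> C)" using grow[OF C(1)] C(2) xF by blast
      also have "\<dots> \<le> rk (insert x F)" using C(3) by (intro rk_mono) blast
      finally show False using x(2) FE(4) by simp
    qed
  qed (use FE(1) in \<open>auto simp: insert_absorb\<close>)
  define k where "k = rk ?E - rk F"
  have rk_E: "rk ?E = rk F + k" using FE(4) by (simp add: k_def)
  \<comment> \<open>Either the ranks of \<open>F\<close> and \<open>X\<close> add up, or some
    circuit meets both and \<open>grow\<close> makes \<open>F \<union> X\<close> spanning.\<close>
  have rk_Un: "rk (F \<union> X) = rk F + min (rk X) k" if X: "X \<subseteq> ?E - F" for X
  proof -
    have le: "rk (F \<union> X) \<le> rk ?E" using X FE(1) by (intro rk_mono) blast
    have le2: "rk (F \<union> X) \<le> rk F + rk X" by (rule rk_Un_le)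
    show ?thesis
    proof (cases "rk (F \<union> X) < rk F + rk X")
      case True
      have "X \<subseteq> ?E" "F \<inter> X = {}" using X by blast+
      then obtain C where C: "circuit M C" "C \<subseteq> F \<union> X" "C \<inter> F \<noteq> {}" "C \<inter> X \<noteq> {}"
        using circuit_meeting_both[OF FE(1) _ _ True] by blast
      have "\<not> C \<subseteq> F" using C(4) X by blast
      then have "rk ?E \<le> rk (F \<union> C)" by (rule grow[OF C(1,3)])
      also have "\<dots> \<le> rk (F \<union> X)" using C(2) by (intro rk_mono) blast
      finally show ?thesis using True le rk_E by simp
    next
      case False
      then show ?thesis using le le2 rk_E by simp
    qed
  qed
  \<comment> \<open>Connectedness supplies a circuit through \<open>e\<close> and an element outside
    \<open>F\<close>, so the ranks of \<open>F\<close> and its complement add up to more than the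
    rank of \<open>M\<close>.\<close>
  have rk_compl: "k < rk (?E - F)"
  proof -
    have "F \<noteq> ?E" using FE(4) by blast
    then obtain x where x: "x \<in> ?E" "x \<notin> F" using FE(1) by blast
    have "e \<noteq> x" using x(2) FE(2) by blast
    then obtain C where C: "circuit M C" "e \<in> C" "x \<in> C"
      using x(1) assms(3) e FE(2) unfolding connected_matroid_def by blast
    have "rk (F \<union> (?E - F)) < rk F + rk (?E - F)"
    proof (rule circuit_across_rk[OF C(1)])
      show "C \<subseteq> F \<union> (?E - F)" using C(1) by (auto simp: circuit_def)
      show "\<not> C \<subseteq> F" "\<not> C \<subseteq> ?E - F" using C(2,3) x(2) FE(2) by blast+
    qed (use FE(1) in auto)
    moreover have "F \<union> (?E - F) = ?E" using FE(1) by blast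
    ultimately show ?thesis using rk_E by simp
  qed
  interpret truncating_set_no_minor M F k
  proof unfold_locales
    fix D assume D: "D \<subseteq> ?E - F" "rk (?E - F - D) < k"
    have "?E - D = F \<union> (?E - F - D)" using D(1) FE(1) by blast
    then have "rk (?E - D) < rk ?E" using rk_Un[of "?E - F - D"] D(2) rk_E by auto
    then show "4 \<le> card D" using D(1) by (intro cogirth) auto
  qed (use FE(1) rk_Un rk_compl simple assms(5,6) in auto)
  have "rk F + 1 = rk ?E" using truncation_rank_le_1 FE(4) rk_E by simp
  then have "hyperplane M F" using flat by (simp add: hyperplane_def)
  moreover have "connected_matroid (restrict_to M F)"
    using FE(1,3) by (simp add: connected_restrict_to_iff)
  ultimately show ?thesis using FE(2) by blast
qed

end
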